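(* Let $I=\langle\mathcal{A},\emptyset,\mathcal{R},\mathcal{R}^?\rangle$ be an AtIAF and $S\subseteq\mathcal{A}$ a set of arguments. Let $w_1,w_2\notin\mathcal{A}$ be two distinct arguments and let $I'=\langle\mathcal{A}\cup\{w_1\},\{w_2\},\mathcal{R}\cup\{(w_2,s)\mid s\in S\},\mathcal{R}^?\cup\{(w_1,w_2)\}\rangle$. Then - $PosVer_{\mathtt{pr}}(I,S)=true$ iff $(w_1,w_2)\in RE^+(I'+\{w_2\},S\cup\{w_1\},\mathtt{pr}\text{-}true)$; and - $PosVer_{\mathtt{pr}}(I,S)=true$ iff $w_2\in RE^-(I'-\{(w_1,w_2)\},S\cup\{w_1\},\mathtt{pr}\text{-}true)$.
   Context: An argumentation framework (AF) is a pair $F=\langle \mathcal{A}_F,\mathcal{R}_F\rangle$ with $\mathcal{R}_F\subseteq\mathcal{A}_F\times\mathcal{A}_F$; $a$ attacks $b$ if $(a,b)\in\mathcal{R}_F$. A set $S\subseteq\mathcal{A}_F$ is conflict-free if no element of $S$ attacks an element of $S$; $S$ defends $a$ if every attacker of $a$ is attacked by some element of $S$; $S\in\mathtt{ad}(F)$ (admissible) iff $S$ is conflict-free and defends each of its elements; $S\in\mathtt{pr}(F)$ (preferred) iff $S$ is $\subseteq$-maximal in $\mathtt{ad}(F)$. $S$ is $\mathtt{pr}$-$true$ in $F$ iff $S\in\mathtt{pr}(F)$. An incomplete argumentation framework (IAF) is $I=\langle\mathcal{A},\mathcal{A}^?,\mathcal{R},\mathcal{R}^?\rangle$ with $\mathcal{A},\mathcal{A}^?$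 disjoint sets of (certain, uncertain) arguments and $\mathcal{R},\mathcal{R}^?$ disjoint subsets of $(\mathcal{A}\cup\mathcal{A}^?)\times(\mathcal{A}\cup\mathcal{A}^?)$ (certain, uncertain attacks). An AtIAF is an IAF with $\mathcal{A}^?=\emptyset$. A partial completion of $I$ is an IAF $I'=\langle\mathcal{A}',\mathcal{A}^{?'},\mathcal{R}',\mathcal{R}^{?'}\rangle$ with $\mathcal{A}\subseteq\mathcal{A}'\subseteq\mathcal{A}\cup\mathcal{A}^?$, $\mathcal{R}\cap((\mathcal{A}'\cup\mathcal{A}^{?'})\times(\mathcal{A}'\cup\mathcal{A}^{?'}))\subseteq\mathcal{R}'\subseteq\mathcal{R}\cup\mathcal{R}^?$, $\mathcal{A}^{?'}\subseteq\mathcal{A}^?$, $\mathcal{R}^{?'}\subseteq\mathcal{R}^?$; $part(I)$ is the set of partial completions. $cert(I)=\langle\mathcal{A},\mathcal{R}\cap(\mathcal{A}\times\mathcal{A})\rangle$. A completion of $I$ is an AF of the form $cert(I')$ with $I'\in part(I)$. $PosVer_{\mathtt{pr}}(I,S)=true$ iff there is a completion $F$ of $I$ with $S\in\mathtt{pr}(F)$. For $\mathcal{R}_0\subseteq\mathcal{R}^?$: $I+\mathcal{R}_0=\langle\mathcal{A},\mathcal{A}^?,\mathcal{R}\cup\mathcal{R}_0,\mathcal{R}^?\setminus\mathcal{R}_0\rangle$, $I-\mathcal{R}_0=\langle\mathcal{A},\mathcal{A}^?,\mathcal{R},\mathcal{R}^?\setminus\mathcal{R}_0\rangle$. For $\mathcal{A}_0\subseteq\mathcal{A}^?$: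 $I+\mathcal{A}_0=\langle\mathcal{A}\cup\mathcal{A}_0,\mathcal{A}^?\setminus\mathcal{A}_0,\mathcal{R},\mathcal{R}^?\rangle$, and $I-\mathcal{A}_0=\langle\mathcal{A},\mathcal{A}^?\setminus\mathcal{A}_0,\mathcal{R}\setminus\mathcal{R}'',\mathcal{R}^?\setminus\mathcal{R}''\rangle$ where $\mathcal{R}''$ is the set of attacks in $\mathcal{R}\cup\mathcal{R}^?$ having an endpoint in $\mathcal{A}_0$. Relevance: for an IAF $J$ with uncertain element (argument or attack) $e$ and a set $T$ of arguments of $J$, $e\in RE^+(J,T,\mathtt{pr}\text{-}true)$ (resp. $e\in RE^-(J,T,\mathtt{pr}\text{-}true)$) iff there is $J'=\langle\mathcal{A}',\mathcal{A}^{?'},\mathcal{R}',\mathcal{R}^{?'}\rangle\in part(J)$ with $\mathcal{A}^{?'}\cup\mathcal{R}^{?'}=\{e\}$ such that $T$ is $\mathtt{pr}$-$true$ in $cert(J'+\{e\})$ (resp. $cert(J'-\{e\})$) and $T$ is not $\mathtt{pr}$-$true$ in $cert(J'-\{e\})$ (resp. $cert(J'+\{e\})$). *)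

theory Defs
  imports Main
begin

record 'a af =
  args :: "'a set"
  atts :: "('a \<times> 'a) set"

definition wf_af :: "'a af \<Rightarrow> bool" where
  "wf_af F \<longleftrightarrow> atts F \<subseteq> args F \<times> args F"

definition conflict_free :: "'a af \<Rightarrow> 'a set \<Rightarrow> bool" where
  "conflict_free F S \<longleftrightarrow> S \<subseteq> args F \<and> (\<forall>a\<in>S. \<forall>b\<in>S. (a, b) \<notin> atts F)"

definition defends :: "'a af \<Rightarrow> 'a set \<Rightarrow> 'a \<Rightarrow> bool" where
  "defends F S a \<longleftrightarrow> (\<forall>b. (b, a) \<in> atts F \<longrightarrow> (\<exists>c\<in>S. (c, b) \<in> atts F))"

definition ad :: "'a af \<Rightarrow> 'a set set" where
  "ad F = {S. conflict_free F S \<and> (\<forall>a\<in>S. defends F S a)}"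

definition pr :: "'a af \<Rightarrow> 'a set set" where
  "pr F = {S \<in> ad F. \<forall>T\<in>ad F. S \<subseteq> T \<longrightarrow> T = S}"

definition pr_true :: "'a set \<Rightarrow> 'a af \<Rightarrow> bool" where
  "pr_true S F \<longleftrightarrow> S \<in> pr F"

record 'a iaf =
  cargs :: "'a set"
  uargs :: "'a set"
  catts :: "('a \<times> 'a) set"
  uatts :: "('a \<times> 'a) set"

definition wf_iaf :: "'a iaf \<Rightarrow> bool" where
  "wf_iaf I \<longleftrightarrow>
     cargs I \<inter> uargs I = {} \<and> catts I \<inter> uatts I = {} \<and>
     catts I \<subseteq> (cargs I \<union> uargs I) \<times> (cargs I \<union> uargs I) \<and>
     uatts I \<subseteq> (cargs I \<union> uargs I) \<times> (cargs I \<union> uargs I)"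

definition at_iaf :: "'a iaf \<Rightarrow> bool" where
  "at_iaf I \<longleftrightarrow> wf_iaf I \<and> uargs I = {}"

definition part :: "'a iaf \<Rightarrow> 'a iaf set" where
  "part I = {I'. wf_iaf I' \<and>
     cargs I \<subseteq> cargs I' \<and> cargs I' \<subseteq> cargs I \<union> uargs I \<and>
     catts I \<inter> ((cargs I' \<union> uargs I') \<times> (cargs I' \<union> uargs I')) \<subseteq> catts I' \<and>
     catts I' \<subseteq> catts I \<union> uatts I \<and>
     uargs I' \<subseteq> uargs I \<and> uatts I' \<subseteq> uatts I}"

definition cert :: "'a iaf \<Rightarrow> 'a af" where
  "cert I = \<lparr>args = cargs I, atts = catts I \<inter> (cargs I \<times> cargs I)\<rparr>"

lemma wf_af_cert: "wf_af (cert I)"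
  by (simp add: wf_af_def cert_def)

definition completions :: "'a iaf \<Rightarrow> 'a af set" where
  "completions I = cert ` part I"

definition PosVer :: "('a af \<Rightarrow> 'a set set) \<Rightarrow> 'a iaf \<Rightarrow> 'a set \<Rightarrow> bool" where
  "PosVer \<sigma> I S \<longleftrightarrow> (\<exists>F\<in>completions I. S \<in> \<sigma> F)"

text \<open>The next four operations are meant for a set of uncertain attacks (resp. uncertain
  arguments) of the given framework.\<close>

definition add_atts :: "'a iaf \<Rightarrow> ('a \<times> 'a) set \<Rightarrow> 'a iaf" where
  "add_atts I R0 = \<lparr>cargs = cargs I, uargs = uargs I,
     catts = catts I \<union> R0, uatts = uatts I - R0\<rparr>"

definition del_atts :: "'a iaf \<Rightarrow> ('a \<times> 'a) set \<Rightarrow> 'a iaf" where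
  "del_atts I R0 = \<lparr>cargs = cargs I, uargs = uargs I,
     catts = catts I, uatts = uatts I - R0\<rparr>"

definition add_args :: "'a iaf \<Rightarrow> 'a set \<Rightarrow> 'a iaf" where
  "add_args I A0 = \<lparr>cargs = cargs I \<union> A0, uargs = uargs I - A0,
     catts = catts I, uatts = uatts I\<rparr>"

definition del_args :: "'a iaf \<Rightarrow> 'a set \<Rightarrow> 'a iaf" where
  "del_args I A0 =
     (let R'' = {(a, b) \<in> catts I \<union> uatts I. a \<in> A0 \<or> b \<in> A0}
      in \<lparr>cargs = cargs I, uargs = uargs I - A0,
          catts = catts I - R'', uatts = uatts I - R''\<rparr>)"

text \<open>An element is an argument or an attack; the tags make the union of the uncertain
  arguments and the uncertain attacks a disjoint one.\<close>

datatype 'a element = Arg 'a | Att "'a \<times> 'a"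

definition uncertain_elements :: "'a iaf \<Rightarrow> 'a element set" where
  "uncertain_elements I = Arg ` uargs I \<union> Att ` uatts I"

fun add_element :: "'a iaf \<Rightarrow> 'a element \<Rightarrow> 'a iaf" where
  "add_element I (Arg a) = add_args I {a}"
| "add_element I (Att r) = add_atts I {r}"

fun del_element :: "'a iaf \<Rightarrow> 'a element \<Rightarrow> 'a iaf" where
  "del_element I (Arg a) = del_args I {a}"
| "del_element I (Att r) = del_atts I {r}"

definition RE_plus :: "'a iaf \<Rightarrow> 'a set \<Rightarrow> ('a set \<Rightarrow> 'a af \<Rightarrow> bool) \<Rightarrow> 'a element set" where
  "RE_plus J T P = {e \<in> uncertain_elements J. \<exists>J'\<in>part J. uncertain_elements J' = {e} \<and>
     P T (cert (add_element J' e)) \<and> \<not> P T (cert (del_element J' e))}"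

definition RE_minus :: "'a iaf \<Rightarrow> 'a set \<Rightarrow> ('a set \<Rightarrow> 'a af \<Rightarrow> bool) \<Rightarrow> 'a element set" where
  "RE_minus J T P = {e \<in> uncertain_elements J. \<exists>J'\<in>part J. uncertain_elements J' = {e} \<and>
     P T (cert (del_element J' e)) \<and> \<not> P T (cert (add_element J' e))}"

end

theory Submission
  imports Defs
begin

text \<open>Once \<open>w1\<close> eliminates \<open>w2\<close>, or \<open>w2\<close> is absent, the preferred sets that contain \<open>w1\<close> are
  exactly the preferred sets of the original framework with \<open>w1\<close> added. If \<open>w2\<close> is present and
  unattacked, it belongs to every preferred set, so \<open>S \<union> {w1}\<close> is not preferred. Hence the last
  uncertain element is relevant precisely when the remaining choices form a completion in which
  \<open>S\<close> is preferred.\<close>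

section \<open>Admissible and preferred sets\<close>

lemma mem_ad_iff:
  "E \<in> ad F \<longleftrightarrow> E \<subseteq> args F \<and> (\<forall>a\<in>E. \<forall>b\<in>E. (a, b) \<notin> atts F) \<and>
     (\<forall>a\<in>E. \<forall>b. (b, a) \<in> atts F \<longrightarrow> (\<exists>c\<in>E. (c, b) \<in> atts F))"
  by (auto simp: ad_def conflict_free_def defends_def)

lemma
  assumes "E \<in> ad F"
  shows ad_no_attack: "a \<in> E \<Longrightarrow> b \<in> E \<Longrightarrow> (a, b) \<notin> atts F"
    and ad_counterattack: "a \<in> E \<Longrightarrow> (b, a) \<in> atts F \<Longrightarrow> \<exists>c\<in>E. (c, b) \<in> atts F"
  using assms unfolding mem_ad_iff by simp_all

text \<open>An unattacked \<open>w\<close> needs no defence, so adding it to \<open>E\<close> keeps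
  admissibility; maximality of \<open>E\<close> then forces \<open>w\<close> into it.\<close>

lemma unattacked_mem_pr:
  assumes "E \<in> pr F" "w \<in> args F" and unattacked: "\<And>b. (b, w) \<notin> atts F"
  shows "w \<in> E"
proof -
  have E: "E \<in> ad F" using assms(1) by (simp add: pr_def)
  \<comment> \<open>\<open>w\<close> attacks no element of \<open>E\<close>, since \<open>E\<close> would have to counterattack it.\<close>
  have "(w, a) \<notin> atts F" if "a \<in> E" for a
    using E that unattacked unfolding mem_ad_iff by blast
  then have "insert w E \<in> ad F"
    using E assms(2) unattacked unfolding mem_ad_iff by blast
  then have "insert w E = E" using assms(1) by (auto simp: pr_def)
  then show ?thesis by blast
qed

section \<open>Extending a framework by a guard and the arguments it defeats\<close>

text \<open>The guard \<open>w\<close> attacks all of \<open>W\<close> and nothing else, while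
  arguments of \<open>W\<close> may attack only \<open>F\<close>. Leaving \<open>W\<close> arbitrary
  covers two situations at once: a defeated newcomer (\<open>W\<close> a singleton) and an absent
  one (\<open>W\<close> and \<open>B\<close> empty).\<close>

locale guarded_extension =
  fixes F :: "'a af" and w :: 'a and W :: "'a set" and B :: "('a \<times> 'a) set"
  assumes wf: "wf_af F"
    and fresh: "w \<notin> args F" "w \<notin> W" "W \<inter> args F = {}"
    and guard: "{w} \<times> W \<subseteq> B" "B \<subseteq> {w} \<times> W \<union> W \<times> args F"
begin

definition ext :: "'a af" where
  "ext = \<lparr>args = insert w (args F \<union> W), atts = atts F \<union> B\<rparr>"

text \<open>Every attack in \<open>B\<close> has an endpoint in \<open>W\<close>, so none is added
  between the remaining arguments.\<close>

lemma mem_atts_ext_iff: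
  assumes "c \<in> insert w (args F)" "b \<in> insert w (args F)"
  shows "(c, b) \<in> atts ext \<longleftrightarrow> (c, b) \<in> atts F"
proof -
  have "c \<notin> W" using assms(1) fresh by blast
  then show ?thesis using assms(2) fresh guard(2) by (auto simp: ext_def)
qed

lemma w_attacks_W:
  assumes "b \<in> W"
  shows "(w, b) \<in> atts ext"
  using assms guard(1) by (auto simp: ext_def)

lemma mem_attsD:
  assumes "(c, b) \<in> atts F"
  shows "c \<in> args F" "b \<in> args F" "c \<noteq> w" "b \<noteq> w"
proof -
  have "(c, b) \<in> args F \<times> args F" using wf assms unfolding wf_af_def by (rule subsetD)
  then show "c \<in> args F" "b \<in> args F" "c \<noteq> w" "b \<noteq> w" using fresh(1) by auto
qed

text \<open>The guard answers every attack coming from \<open>W\<close>. It attacks nothing in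
  \<open>F\<close>, so attacks coming from \<open>F\<close> must still be answered by
  \<open>U\<close> alone.\<close>

lemma insert_mem_ad_ext_iff:
  assumes "U \<subseteq> args F"
  shows "insert w U \<in> ad ext \<longleftrightarrow> U \<in> ad F"
proof
  assume U: "insert w U \<in> ad ext"
  have "(a, b) \<notin> atts F" if "a \<in> U" "b \<in> U" for a b
    using ad_no_attack[OF U, of a b] that by (simp add: ext_def)
  moreover have "\<exists>c\<in>U. (c, b) \<in> atts F" if a: "a \<in> U" and ba: "(b, a) \<in> atts F" for a b
  proof -
    have b: "b \<in> args F" using ba by (rule mem_attsD)
    have "(b, a) \<in> atts ext" using ba by (simp add: ext_def)
    then obtain c where c: "c \<in> insert w U" "(c, b) \<in> atts ext"
      using ad_counterattack[OF U insertI2[OF a]] by blast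
    have "c \<in> insert w (args F)" using c(1) assms by blast
    then have "(c, b) \<in> atts F" using c(2) b mem_atts_ext_iff by simp
    \<comment> \<open>No attack of \<open>F\<close> starts at \<open>w\<close>, so the
      counterattacker lies in \<open>U\<close>.\<close>
    then show ?thesis using c(1) mem_attsD(3) by auto
  qed
  ultimately show "U \<in> ad F" using assms unfolding mem_ad_iff by simp
next
  assume U: "U \<in> ad F"
  have sub: "insert w U \<subseteq> insert w (args F)" using assms by blast
  then have "insert w U \<subseteq> args ext" by (auto simp: ext_def)
  moreover have "(a, b) \<notin> atts ext" if ab: "a \<in> insert w U" "b \<in> insert w U" for a b
  proof
    assume "(a, b) \<in> atts ext"
    then have "(a, b) \<in> atts F"
      using mem_atts_ext_iff[OF subsetD[OF sub ab(1)] subsetD[OF sub ab(2)]] by simp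
    then show False using ab ad_no_attack[OF U, of a b] mem_attsD(3,4) by auto
  qed
  moreover have "\<exists>c\<in>insert w U. (c, b) \<in> atts ext"
    if a: "a \<in> insert w U" and ba: "(b, a) \<in> atts ext" for a b
  proof (cases "b \<in> W")
    case True
    then show ?thesis using w_attacks_W by blast
  next
    case False
    have "a \<in> insert w (args F)" using a sub by blast
    then have "a \<notin> W" using fresh by blast
    \<comment> \<open>An attack in \<open>B\<close> that starts outside \<open>W\<close> ends in
      \<open>W\<close>. Hence this one belongs to \<open>F\<close>, its target differs from
      \<open>w\<close>, and \<open>U\<close> answers it.\<close>
    then have "(b, a) \<notin> B" using False subsetD[OF guard(2), of "(b, a)"] by blast
    then have "(b, a) \<in> atts F" using ba by (simp add: ext_def)
    then obtain c where "c \<in> U" "(c, b) \<in> atts F"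
      using a mem_attsD(4) ad_counterattack[OF U] by blast
    then show ?thesis by (auto simp: ext_def)
  qed
  ultimately show "insert w U \<in> ad ext" unfolding mem_ad_iff by simp
qed

text \<open>A conflict-free set containing \<open>w\<close> avoids \<open>W\<close>, because
  \<open>w\<close> attacks all of it; only arguments of \<open>F\<close> remain beside
  \<open>w\<close>.\<close>

lemma mem_ad_extE:
  assumes "E \<in> ad ext" "w \<in> E"
  obtains U where "E = insert w U" "U \<subseteq> args F" "U \<in> ad F"
proof -
  have "E \<inter> W = {}" using assms guard(1) by (auto simp: mem_ad_iff ext_def)
  then have U: "E - {w} \<subseteq> args F" using assms by (auto simp: mem_ad_iff ext_def)
  moreover have E: "E = insert w (E - {w})" using assms(2) by blast
  ultimately have "E - {w} \<in> ad F" using insert_mem_ad_ext_iff assms(1) by metis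
  with that E U show thesis by blast
qed

text \<open>The map \<open>insert w\<close> is an inclusion-preserving bijection from the admissible
  sets of \<open>F\<close> onto those of \<open>ext\<close> that contain \<open>w\<close>, so
  maximality transfers both ways.\<close>

lemma insert_mem_pr_ext_iff:
  assumes "U \<subseteq> args F"
  shows "insert w U \<in> pr ext \<longleftrightarrow> U \<in> pr F"
proof
  assume pr: "insert w U \<in> pr ext"
  have "V = U" if V: "V \<in> ad F" "U \<subseteq> V" for V
  proof -
    have sub: "V \<subseteq> args F" using V(1) by (simp add: mem_ad_iff)
    then have "insert w V \<in> ad ext" using V(1) insert_mem_ad_ext_iff by blast
    then have "insert w V = insert w U" using pr insert_mono[OF V(2)] by (simp add: pr_def)
    then show ?thesis using sub assms fresh(1) by (metis insert_ident subsetD)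
  qed
  moreover have "U \<in> ad F" using pr insert_mem_ad_ext_iff[OF assms] by (simp add: pr_def)
  ultimately show "U \<in> pr F" unfolding pr_def by blast
next
  assume pr: "U \<in> pr F"
  have "E = insert w U" if E: "E \<in> ad ext" "insert w U \<subseteq> E" for E
  proof -
    obtain V where V: "E = insert w V" "V \<subseteq> args F" "V \<in> ad F"
      using E mem_ad_extE by blast
    then have "U \<subseteq> V" using E(2) assms fresh(1) by blast
    then show ?thesis using V pr by (auto simp: pr_def)
  qed
  moreover have "insert w U \<in> ad ext" using pr insert_mem_ad_ext_iff[OF assms] by (simp add: pr_def)
  ultimately show "insert w U \<in> pr ext" unfolding pr_def by blast
qed

end

section \<open>Completions and uncertain elements\<close>

text \<open>Without uncertain arguments, a completion amounts to a choice \<open>X\<close> of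
  attacks between the certain ones and all possible ones.\<close>

lemma PosVer_at_iaf:
  assumes "at_iaf I"
  shows "PosVer \<sigma> I S \<longleftrightarrow>
    (\<exists>X. catts I \<subseteq> X \<and> X \<subseteq> catts I \<union> uatts I \<and> S \<in> \<sigma> \<lparr>args = cargs I, atts = X\<rparr>)"
proof
  assume "PosVer \<sigma> I S"
  then obtain K where K: "K \<in> part I" "S \<in> \<sigma> (cert K)"
    by (auto simp: PosVer_def completions_def)
  have "cargs K = cargs I" "uargs K = {}"
    using K(1) assms by (auto simp: part_def at_iaf_def)
  moreover have "catts I \<subseteq> catts K" "catts K \<subseteq> catts I \<union> uatts I"
      "catts K \<subseteq> cargs I \<times> cargs I"
    using K(1) assms calculation by (auto simp: part_def at_iaf_def wf_iaf_def)
  moreover from this have "cert K = \<lparr>args = cargs I, atts = catts K\<rparr>"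
    using calculation(1) by (auto simp: cert_def)
  ultimately show "\<exists>X. catts I \<subseteq> X \<and> X \<subseteq> catts I \<union> uatts I \<and>
      S \<in> \<sigma> \<lparr>args = cargs I, atts = X\<rparr>"
    using K(2) by metis
next
  assume "\<exists>X. catts I \<subseteq> X \<and> X \<subseteq> catts I \<union> uatts I \<and> S \<in> \<sigma> \<lparr>args = cargs I, atts = X\<rparr>"
  then obtain X where X: "catts I \<subseteq> X" "X \<subseteq> catts I \<union> uatts I"
      "S \<in> \<sigma> \<lparr>args = cargs I, atts = X\<rparr>" by blast
  \<comment> \<open>Every uncertain attack is decided according to \<open>X\<close>, so nothing
    stays uncertain.\<close>
  let ?K = "\<lparr>cargs = cargs I, uargs = {}, catts = X, uatts = {}\<rparr>"
  have "uargs I = {}" using assms by (simp add: at_iaf_def)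
  then have "catts I \<union> uatts I \<subseteq> cargs I \<times> cargs I"
    using assms by (simp add: at_iaf_def wf_iaf_def)
  then have "X \<subseteq> cargs I \<times> cargs I" using X(2) by (rule order_trans[rotated])
  then have K: "?K \<in> part I" and cert: "cert ?K = \<lparr>args = cargs I, atts = X\<rparr>"
    using X(1,2) by (simp_all add: part_def wf_iaf_def cert_def le_infI1 Int_absorb2)
  have "cert ?K \<in> completions I" unfolding completions_def using K by (rule imageI)
  then show "PosVer \<sigma> I S" unfolding PosVer_def cert using X(3) by (rule bexI[rotated])
qed

lemma cert_eqI:
  "cargs K = V \<Longrightarrow> catts K = Y \<Longrightarrow> Y \<subseteq> V \<times> V \<Longrightarrow> cert K = \<lparr>args = V, atts = Y\<rparr>"
  by (simp add: cert_def Int_absorb2)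

lemma mem_uncertain_elements_iff [simp]:
  "Arg a \<in> uncertain_elements K \<longleftrightarrow> a \<in> uargs K"
  "Att r \<in> uncertain_elements K \<longleftrightarrow> r \<in> uatts K"
  by (auto simp: uncertain_elements_def)

lemma uncertain_elements_eq_iff:
  "uncertain_elements K = E \<longleftrightarrow> uargs K = {a. Arg a \<in> E} \<and> uatts K = {r. Att r \<in> E}"
proof
  assume "uargs K = {a. Arg a \<in> E} \<and> uatts K = {r. Att r \<in> E}"
  then have "e \<in> uncertain_elements K \<longleftrightarrow> e \<in> E" for e by (cases e) simp_all
  then show "uncertain_elements K = E" by (rule set_eqI)
qed auto

theorem proposition5:
  fixes I I' :: "'a iaf" and S :: "'a set" and w1 w2 :: 'a
  assumes "at_iaf I"
    and "S \<subseteq> cargs I"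
    and "w1 \<notin> cargs I" and "w2 \<notin> cargs I" and "w1 \<noteq> w2"
    and "I' = \<lparr>cargs = cargs I \<union> {w1}, uargs = {w2},
                catts = catts I \<union> {(w2, s) | s. s \<in> S},
                uatts = uatts I \<union> {(w1, w2)}\<rparr>"
  shows "(PosVer pr I S \<longleftrightarrow>
            Att (w1, w2) \<in> RE_plus (add_args I' {w2}) (S \<union> {w1}) pr_true) \<and>
         (PosVer pr I S \<longleftrightarrow>
            Arg w2 \<in> RE_minus (del_atts I' {(w1, w2)}) (S \<union> {w1}) pr_true)"
proof -

  \<comment> \<open>Attack choices in \<open>I\<close> and in the extended framework\<close>
  define A D where "A = cargs I" and "D = {w2} \<times> S"
  have D_eq: "{(w2, s) | s. s \<in> S} = D" by (auto simp: D_def)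
  note I' = assms(6)[unfolded D_eq, folded A_def]
  have A: "S \<subseteq> A" "w1 \<notin> A" "w2 \<notin> A" using assms(2-4) by (auto simp: A_def)
  have I: "uargs I = {}" "catts I \<inter> uatts I = {}" "catts I \<subseteq> A \<times> A" "uatts I \<subseteq> A \<times> A"
    using assms(1) by (auto simp: at_iaf_def wf_iaf_def A_def)
  let ?R = "\<lambda>X. catts I \<subseteq> X \<and> X \<subseteq> catts I \<union> uatts I"
  have PosVer: "PosVer pr I S \<longleftrightarrow> (\<exists>X. ?R X \<and> S \<in> pr \<lparr>args = A, atts = X\<rparr>)"
    using PosVer_at_iaf[OF assms(1)] by (simp add: A_def)
  have XA: "X \<subseteq> A \<times> A" if "?R X" for X
    using that I(3,4) by (meson Un_least order_trans)

  define V where "V = insert w1 (insert w2 A)"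
  have AV: "A \<times> A \<subseteq> V \<times> V" unfolding V_def by (intro Sigma_mono subset_insertI2 order_refl)
  have DV: "D \<subseteq> V \<times> V" unfolding D_def V_def using A(1) by (intro Sigma_mono) auto
  have XV: "X \<union> D \<subseteq> V \<times> V" if "?R X" for X
    using Un_least[OF order_trans[OF XA[OF that] AV] DV] .
  have w: "w1 \<in> V" "w2 \<in> V" by (simp_all add: V_def)
  have no_w2: "(w2, b) \<notin> X" "(b, w2) \<notin> X" if "?R X" for X b
    using subsetD[OF XA[OF that]] A(3) by auto
  have w12_notin: "(w1, w2) \<notin> D" using assms(5) by (simp add: D_def)
  have D_disjoint: "catts I \<inter> D = {}" using no_w2(1)[of "catts I"] by (auto simp: D_def)
  \<comment> \<open>Removing \<open>D\<close> recovers the choice made in \<open>I\<close>; no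
    certain attack of \<open>I\<close> is lost, since none starts at \<open>w2\<close>.\<close>
  have split: "\<exists>X. ?R X \<and> Y = X \<union> D"
    if "catts I \<union> D \<subseteq> Y" "Y \<subseteq> catts I \<union> D \<union> uatts I" for Y
    using that D_disjoint by (intro exI[of _ "Y - D"]) auto

  \<comment> \<open>The three fates of \<open>w2\<close>: defeated by \<open>w1\<close>, unattacked,
    absent\<close>
  let ?T = "insert w1 S"
  let ?F = "\<lambda>X. \<lparr>args = A, atts = X\<rparr>"
  let ?Fdef = "\<lambda>X. \<lparr>args = V, atts = X \<union> insert (w1, w2) D\<rparr>"
  let ?Fun = "\<lambda>X. \<lparr>args = V, atts = X \<union> D\<rparr>"
  let ?Fabs = "\<lambda>X. \<lparr>args = insert w1 A, atts = X\<rparr>"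
  have pr_def': "?T \<in> pr (?Fdef X) \<longleftrightarrow> S \<in> pr (?F X)" if "?R X" for X
  proof -
    interpret guarded_extension "?F X" w1 "{w2}" "insert (w1, w2) D"
      using XA[OF that] A assms(5) by unfold_locales (auto simp: wf_af_def D_def)
    show ?thesis using insert_mem_pr_ext_iff[of S] A(1) by (simp add: ext_def V_def)
  qed
  have pr_abs: "?T \<in> pr (?Fabs X) \<longleftrightarrow> S \<in> pr (?F X)" if "?R X" for X
  proof -
    interpret guarded_extension "?F X" w1 "{}" "{}"
      using XA[OF that] A by unfold_locales (auto simp: wf_af_def)
    show ?thesis using insert_mem_pr_ext_iff[of S] A(1) by (simp add: ext_def)
  qed
  \<comment> \<open>Arguing through maximality rather than through the attacks of \<open>w2\<close>
    on \<open>S\<close> also covers empty \<open>S\<close>, where \<open>D\<close> is empty.\<close>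
  have not_pr: "?T \<notin> pr (?Fun X)" if "?R X" for X
  proof
    assume T: "?T \<in> pr (?Fun X)"
    have "(b, w2) \<notin> X \<union> D" for b using no_w2(2)[OF that] A by (auto simp: D_def)
    then have "w2 \<in> ?T" using w by (intro unattacked_mem_pr[OF T]) simp_all
    then show False using A assms(5) by blast
  qed

  \<comment> \<open>Relevance of the attack \<open>(w1, w2)\<close>\<close>
  let ?J1 = "add_args I' {w2}"
  have J1: "?J1 = \<lparr>cargs = V, uargs = {}, catts = catts I \<union> D,
      uatts = insert (w1, w2) (uatts I)\<rparr>"
    by (auto simp: add_args_def I' V_def)
  have plus: "Att (w1, w2) \<in> RE_plus ?J1 (S \<union> {w1}) pr_true \<longleftrightarrow> (\<exists>X. ?R X \<and> S \<in> pr (?F X))"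
  proof
    assume "Att (w1, w2) \<in> RE_plus ?J1 (S \<union> {w1}) pr_true"
    then obtain K where K: "K \<in> part ?J1" "uargs K = {}" "uatts K = {(w1, w2)}"
        "?T \<in> pr (cert (add_atts K {(w1, w2)}))"
      by (auto simp: RE_plus_def uncertain_elements_eq_iff pr_true_def)
    have cargs: "cargs K = V" using K(1) by (auto simp: part_def J1)
    \<comment> \<open>Certain and uncertain attacks are disjoint; this removes
      \<open>(w1, w2)\<close> from the upper bound on \<open>catts K\<close>.\<close>
    have w12: "(w1, w2) \<notin> catts K" using K(1,3) by (simp add: part_def wf_iaf_def)
    \<comment> \<open>A partial completion must keep only those certain attacks whose endpoints
      remain; here all endpoints do.\<close>
    have "catts I \<union> D \<subseteq> (cargs K \<union> uargs K) \<times> (cargs K \<union> uargs K)"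
      using XV[of "catts I"] by (simp add: cargs K(2) V_def insert_commute)
    then have "catts I \<union> D \<subseteq> catts K" "catts K \<subseteq> catts I \<union> D \<union> uatts I"
      using K(1) w12 by (simp_all add: part_def J1 Int_absorb2 subset_insert)
    then obtain X where X: "?R X" "catts K = X \<union> D" using split by blast
    have "cert (add_atts K {(w1, w2)}) = ?Fdef X"
      using XV[OF X(1)] w by (intro cert_eqI) (simp_all add: add_atts_def cargs X(2))
    then show "\<exists>X. ?R X \<and> S \<in> pr (?F X)" using K(4) pr_def'[OF X(1)] X(1) by auto
  next
    assume "\<exists>X. ?R X \<and> S \<in> pr (?F X)"
    then obtain X where X: "?R X" "S \<in> pr (?F X)" by blast
    \<comment> \<open>The uncertain attacks of \<open>I\<close> are settled by \<open>X\<close>;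
      only \<open>(w1, w2)\<close> stays open. Accepting it defeats \<open>w2\<close>, rejecting it
      leaves \<open>w2\<close> unattacked.\<close>
    let ?K = "\<lparr>cargs = V, uargs = {}, catts = X \<union> D, uatts = {(w1, w2)}\<rparr>"
    have part: "?K \<in> part ?J1"
      using X(1) XV[OF X(1)] w w12_notin no_w2(2)[OF X(1), of w1]
      by (simp add: part_def J1 wf_iaf_def le_supI1 le_supI2 Un_least le_infI1) blast
    have "cert (add_atts ?K {(w1, w2)}) = ?Fdef X"
      using XV[OF X(1)] w by (intro cert_eqI) (simp_all add: add_atts_def)
    then have pos: "?T \<in> pr (cert (add_atts ?K {(w1, w2)}))"
      using X(2) by (simp only: pr_def'[OF X(1)])
    have "cert (del_atts ?K {(w1, w2)}) = ?Fun X"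
      using XV[OF X(1)] by (intro cert_eqI) (simp_all add: del_atts_def)
    then have neg: "?T \<notin> pr (cert (del_atts ?K {(w1, w2)}))"
      using not_pr[OF X(1)] by (simp only: not_False_eq_True)
    have "Att (w1, w2) \<in> uncertain_elements ?J1" by (simp add: uncertain_elements_def J1)
    moreover have "uncertain_elements ?K = {Att (w1, w2)}"
      by (simp add: uncertain_elements_eq_iff)
    ultimately show "Att (w1, w2) \<in> RE_plus ?J1 (S \<union> {w1}) pr_true"
      unfolding RE_plus_def pr_true_def using part pos neg by fastforce
  qed

  \<comment> \<open>Relevance of the argument \<open>w2\<close>\<close>
  let ?J2 = "del_atts I' {(w1, w2)}"
  have J2: "?J2 = \<lparr>cargs = insert w1 A, uargs = {w2}, catts = catts I \<union> D, uatts = uatts I\<rparr>"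
    using I A by (auto simp: del_atts_def I')
  have cert_del: "cert (del_args K {w2}) = ?Fabs X"
    if X: "?R X" and K: "catts K = X \<union> D" "cargs K = insert w1 A" "uatts K = {}" for K X
  proof (rule cert_eqI)
    show "cargs (del_args K {w2}) = insert w1 A" by (simp add: del_args_def K)
    \<comment> \<open>Deleting \<open>w2\<close> takes all of \<open>D\<close> with it, and nothing
      from \<open>X\<close>.\<close>
    have "(X \<union> D) - {(a, b). ((a, b) \<in> X \<or> (a, b) \<in> D) \<and> (a = w2 \<or> b = w2)} = X"
      using no_w2[OF X] by (auto simp: D_def)
    then show "catts (del_args K {w2}) = X" by (simp add: del_args_def Let_def K)
    show "X \<subseteq> insert w1 A \<times> insert w1 A"
      using XA[OF X] by (rule order_trans) (intro Sigma_mono subset_insertI)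
  qed
  have minus: "Arg w2 \<in> RE_minus ?J2 (S \<union> {w1}) pr_true \<longleftrightarrow> (\<exists>X. ?R X \<and> S \<in> pr (?F X))"
  proof
    assume "Arg w2 \<in> RE_minus ?J2 (S \<union> {w1}) pr_true"
    then obtain K where K: "K \<in> part ?J2" "uargs K = {w2}" "uatts K = {}"
        "?T \<in> pr (cert (del_args K {w2}))"
      by (auto simp: RE_minus_def uncertain_elements_eq_iff pr_true_def)
    \<comment> \<open>As \<open>w2\<close> is still uncertain in \<open>K\<close>, disjointness
      keeps it out of the certain arguments.\<close>
    have cargs: "cargs K = insert w1 A"
      using K(1,2) by (auto simp: part_def J2 wf_iaf_def)
    have "catts I \<union> D \<subseteq> (cargs K \<union> uargs K) \<times> (cargs K \<union> uargs K)"
      using XV[of "catts I"] by (simp add: cargs K(2) V_def insert_commute)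
    then have "catts I \<union> D \<subseteq> catts K" "catts K \<subseteq> catts I \<union> D \<union> uatts I"
      using K(1) by (simp_all add: part_def J2 Int_absorb2)
    then obtain X where X: "?R X" "catts K = X \<union> D" using split by blast
    have "cert (del_args K {w2}) = ?Fabs X"
      using X cargs K(3) by (rule cert_del)
    then show "\<exists>X. ?R X \<and> S \<in> pr (?F X)" using K(4) pr_abs[OF X(1)] X(1) by auto
  next
    assume "\<exists>X. ?R X \<and> S \<in> pr (?F X)"
    then obtain X where X: "?R X" "S \<in> pr (?F X)" by blast
    let ?K = "\<lparr>cargs = insert w1 A, uargs = {w2}, catts = X \<union> D, uatts = {}\<rparr>"
    have part: "?K \<in> part ?J2"
      using X(1) XV[OF X(1)] A(3) assms(5)
      by (simp add: part_def J2 wf_iaf_def V_def insert_commute le_supI1) blast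
    have "cert (del_args ?K {w2}) = ?Fabs X"
      by (rule cert_del[OF X(1)]) simp_all
    then have pos: "?T \<in> pr (cert (del_args ?K {w2}))"
      using X(2) by (simp only: pr_abs[OF X(1)])
    \<comment> \<open>With \<open>(w1, w2)\<close> already deleted, accepting \<open>w2\<close>
      leaves it unattacked.\<close>
    have "cert (add_args ?K {w2}) = ?Fun X"
      using XV[OF X(1)] by (intro cert_eqI) (simp_all add: add_args_def V_def insert_commute)
    then have neg: "?T \<notin> pr (cert (add_args ?K {w2}))"
      using not_pr[OF X(1)] by (simp only: not_False_eq_True)
    have "Arg w2 \<in> uncertain_elements ?J2" by (simp add: uncertain_elements_def J2)
    moreover have "uncertain_elements ?K = {Arg w2}"
      by (simp add: uncertain_elements_eq_iff)
    ultimately show "Arg w2 \<in> RE_minus ?J2 (S \<union> {w1}) pr_true"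
      unfolding RE_minus_def pr_true_def using part pos neg by fastforce
  qed
  show ?thesis unfolding PosVer plus minus by simp
qed

end
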